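(* Let $n>1$ and let $\{1,n+1\}\subset J\subset[1,n+1]$ with $g(J)>1$. Then for all $m\in\mathbb Z_{>0}$ the element $T_J^m$ of $\mathrm{Br}^+_{n+1}$ is not ${}^{op}$-invariant, i.e. $(T_J^m)^{op}\ne T_J^m$.
   Context: $[a,b]=\{i\in\mathbb Z:a\le i\le b\}$. $\mathrm{Br}^+_{n+1}$ is the braid monoid on $n+1$ strands: generators $T_1,\dots,T_n$, relations $T_iT_j=T_jT_i$ for $|i-j|>1$ and $T_iT_jT_i=T_jT_iT_j$ for $|i-j|=1$. ${}^{op}$ is the unique anti-involution of $\mathrm{Br}^+_{n+1}$ with $T_i^{op}=T_i$ for all $i$. For $1\le i<j\le n+1$ put $T_{(i,j)}=T_iT_{i+1}\cdots T_{j-2}T_{j-1}T_{j-2}\cdots T_{i+1}T_i$ (the square free lift of the transposition $(i,j)$). For $J=\{j_1<j_2<\cdots<j_k\}\subset[1,n+1]$ put $T_J=\tilde\tau_1(J)\tilde\tau_0(J)$, where $$\tilde\tau_1(J)=\prod_{1\le r\le k-1,\ r\text{ odd}}T_{(j_r,j_{r+1})},\qquad\tilde\tau_0(J)=\prod_{1\le r\le k-1,\ r\text{ even}}T_{(j_r,j_{r+1})}$$ (the factors in each product commute pairwise). $g(J)$ is the number of gaps in $J$: $g(J)=|\{j\in J:\ \min J<j\le\max J,\ j-1\notin J\}|$. *)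

theory Defs
  imports "HOL-Algebra.Group"
begin

text \<open>Words are lists of generator indices in \<open>{1..n}\<close>; \<open>braid_cong n\<close> is the monoid congruence
  generated by the braid relations. The relations are closed under left and right
  multiplication by allowing an arbitrary context \<open>u\<close>, \<open>v\<close>.\<close>

inductive_set braid_cong :: "nat \<Rightarrow> (nat list \<times> nat list) set" for n :: nat where
  refl: "w \<in> lists {1..n} \<Longrightarrow> (w, w) \<in> braid_cong n"
| sym: "(v, w) \<in> braid_cong n \<Longrightarrow> (w, v) \<in> braid_cong n"
| trans: "(u, v) \<in> braid_cong n \<Longrightarrow> (v, w) \<in> braid_cong n \<Longrightarrow> (u, w) \<in> braid_cong n"
| far: "u \<in> lists {1..n} \<Longrightarrow> v \<in> lists {1..n} \<Longrightarrow> i \<in> {1..n} \<Longrightarrow> j \<in> {1..n} \<Longrightarrow>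
    \<bar>int i - int j\<bar> > 1 \<Longrightarrow> (u @ [i, j] @ v, u @ [j, i] @ v) \<in> braid_cong n"
| near: "u \<in> lists {1..n} \<Longrightarrow> v \<in> lists {1..n} \<Longrightarrow> i \<in> {1..n} \<Longrightarrow> j \<in> {1..n} \<Longrightarrow>
    \<bar>int i - int j\<bar> = 1 \<Longrightarrow> (u @ [i, j, i] @ v, u @ [j, i, j] @ v) \<in> braid_cong n"

text \<open>The braid monoid on \<open>n + 1\<close> strands.\<close>

definition braid_monoid :: "nat \<Rightarrow> nat list set monoid" where
  "braid_monoid n = \<lparr>
     carrier = lists {1..n} // braid_cong n,
     mult = (\<lambda>X Y. \<Union>x\<in>X. \<Union>y\<in>Y. braid_cong n `` {x @ y}),
     one = braid_cong n `` {[]}\<rparr>"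

definition braid_gen :: "nat \<Rightarrow> nat \<Rightarrow> nat list set" where
  "braid_gen n i = braid_cong n `` {[i]}"

definition anti_involution :: "('a, 'b) monoid_scheme \<Rightarrow> ('a \<Rightarrow> 'a) \<Rightarrow> bool" where
  "anti_involution M f \<longleftrightarrow>
     f \<in> carrier M \<rightarrow> carrier M \<and>
     f \<one>\<^bsub>M\<^esub> = \<one>\<^bsub>M\<^esub> \<and>
     (\<forall>x\<in>carrier M. \<forall>y\<in>carrier M. f (x \<otimes>\<^bsub>M\<^esub> y) = f y \<otimes>\<^bsub>M\<^esub> f x) \<and>
     (\<forall>x\<in>carrier M. f (f x) = x)"

text \<open>Extensionality makes the function unique outside the carrier as well; existence and
  uniqueness are proved in \<open>ex1_braid_op\<close>.\<close>

definition braid_op :: "nat \<Rightarrow> nat list set \<Rightarrow> nat list set" where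
  "braid_op n = (THE f. f \<in> extensional (carrier (braid_monoid n)) \<and>
     anti_involution (braid_monoid n) f \<and> (\<forall>i\<in>{1..n}. f (braid_gen n i) = braid_gen n i))"

definition ordered_prod :: "('a, 'b) monoid_scheme \<Rightarrow> 'a list \<Rightarrow> 'a" where
  "ordered_prod M xs = foldr (\<lambda>x y. x \<otimes>\<^bsub>M\<^esub> y) xs \<one>\<^bsub>M\<^esub>"

text \<open>\<open>T\<^sub>i \<cdots> T\<^sub>j\<^sub>-\<^sub>2 T\<^sub>j\<^sub>-\<^sub>1 T\<^sub>j\<^sub>-\<^sub>2 \<cdots> T\<^sub>i\<close>, meant for \<open>1 \<le> i < j \<le> n + 1\<close>.\<close>

definition braid_transp :: "nat \<Rightarrow> nat \<Rightarrow> nat \<Rightarrow> nat list set" where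
  "braid_transp n i j =
     ordered_prod (braid_monoid n) (map (braid_gen n) ([i..<j] @ rev [i..<j - 1]))"

text \<open>\<open>nth_elem J r\<close> is the \<open>r\<close>-th smallest element of the finite set \<open>J\<close>, counting from 1.\<close>

definition nth_elem :: "nat set \<Rightarrow> nat \<Rightarrow> nat" where
  "nth_elem J r = sorted_list_of_set J ! (r - 1)"

text \<open>The factors of \<open>tau1\<close> (and of \<open>tau0\<close>) commute by \<open>braid_transp_commute\<close>; the products
  are taken in increasing order of \<open>r\<close>, with \<open>r\<close> ranging over \<open>1, \<dots>, card J - 1\<close>.\<close>

definition tau1 :: "nat \<Rightarrow> nat set \<Rightarrow> nat list set" where
  "tau1 n J = ordered_prod (braid_monoid n)
     [braid_transp n (nth_elem J r) (nth_elem J (r + 1)). r \<leftarrow> [1..<card J], odd r]"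

definition tau0 :: "nat \<Rightarrow> nat set \<Rightarrow> nat list set" where
  "tau0 n J = ordered_prod (braid_monoid n)
     [braid_transp n (nth_elem J r) (nth_elem J (r + 1)). r \<leftarrow> [1..<card J], even r]"

definition T_set :: "nat \<Rightarrow> nat set \<Rightarrow> nat list set" where
  "T_set n J = tau1 n J \<otimes>\<^bsub>braid_monoid n\<^esub> tau0 n J"

definition gaps :: "nat set \<Rightarrow> nat" where
  "gaps J = card {j \<in> J. Min J < j \<and> j \<le> Max J \<and> j - 1 \<notin> J}"

subsection \<open>Well-definedness\<close>

lemma braid_cong_in_lists:
  "(v, w) \<in> braid_cong n \<Longrightarrow> v \<in> lists {1..n} \<and> w \<in> lists {1..n}"
  by (induction rule: braid_cong.induct) auto

lemma equiv_braid_cong: "equiv (lists {1..n}) (braid_cong n)"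
proof (rule equivI)
  show "braid_cong n \<subseteq> lists {1..n} \<times> lists {1..n}"
    by (rule subrelI) (use braid_cong_in_lists in blast)
  show "refl_on (lists {1..n}) (braid_cong n)"
    by (rule refl_onI) (rule braid_cong.refl)
  show "sym (braid_cong n)"
    by (rule symI) (rule braid_cong.sym)
  show "trans (braid_cong n)"
    by (rule transI) (rule braid_cong.trans)
qed

lemma braid_cong_context:
  assumes "(v, w) \<in> braid_cong n" "x \<in> lists {1..n}" "y \<in> lists {1..n}"
  shows "(x @ v @ y, x @ w @ y) \<in> braid_cong n"
  using assms
proof (induction rule: braid_cong.induct)
  case (refl w)
  then show ?case by (intro braid_cong.refl) auto
next
  case (sym v w)
  then show ?case by (blast intro: braid_cong.sym)
next
  case (trans u v w)
  then show ?case by (blast intro: braid_cong.trans)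
next
  case (far u v i j)
  then show ?case using braid_cong.far[of "x @ u" n "v @ y" i j] by simp
next
  case (near u v i j)
  then show ?case using braid_cong.near[of "x @ u" n "v @ y" i j] by simp
qed

lemma braid_cong_append:
  assumes "(v, v') \<in> braid_cong n" "(w, w') \<in> braid_cong n"
  shows "(v @ w, v' @ w') \<in> braid_cong n"
proof -
  have l: "w \<in> lists {1..n}" "v' \<in> lists {1..n}" using assms braid_cong_in_lists by blast+
  show ?thesis
    using braid_cong_context[OF assms(1) lists.Nil l(1)]
      braid_cong_context[OF assms(2) l(2) lists.Nil]
    by (auto intro: braid_cong.trans)
qed

lemma braid_cong_rev: "(v, w) \<in> braid_cong n \<Longrightarrow> (rev v, rev w) \<in> braid_cong n"
proof (induction rule: braid_cong.induct)
  case (refl w)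
  then show ?case by (intro braid_cong.refl) auto
next
  case (sym v w)
  then show ?case by (blast intro: braid_cong.sym)
next
  case (trans u v w)
  then show ?case by (blast intro: braid_cong.trans)
next
  case (far u v i j)
  then show ?case using braid_cong.far[of "rev v" n "rev u" j i]
    by (simp add: abs_minus_commute in_lists_conv_set)
next
  case (near u v i j)
  then show ?case using braid_cong.near[of "rev v" n "rev u" i j]
    by (simp add: in_lists_conv_set)
qed

lemma braid_class_eq_iff:
  assumes "v \<in> lists {1..n}" "w \<in> lists {1..n}"
  shows "braid_cong n `` {v} = braid_cong n `` {w} \<longleftrightarrow> (v, w) \<in> braid_cong n"
  using eq_equiv_class_iff[OF equiv_braid_cong assms] .

lemma braid_class_in_carrier:
  "w \<in> lists {1..n} \<Longrightarrow> braid_cong n `` {w} \<in> carrier (braid_monoid n)"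
  by (simp add: braid_monoid_def quotientI)

lemma braid_carrierE:
  assumes "X \<in> carrier (braid_monoid n)"
  obtains w where "w \<in> lists {1..n}" "X = braid_cong n `` {w}"
  using assms unfolding braid_monoid_def partial_object.simps by (rule quotientE)

lemma braid_one: "\<one>\<^bsub>braid_monoid n\<^esub> = braid_cong n `` {[]}"
  by (simp add: braid_monoid_def)

lemma braid_mult_class:
  assumes "v \<in> lists {1..n}" "w \<in> lists {1..n}"
  shows "braid_cong n `` {v} \<otimes>\<^bsub>braid_monoid n\<^esub> braid_cong n `` {w} = braid_cong n `` {v @ w}"
proof -
  have "congruent2 (braid_cong n) (braid_cong n) (\<lambda>x y. braid_cong n `` {x @ y})"
  proof (rule congruent2I')
    fix y1 z1 y2 z2
    assume "(y1, z1) \<in> braid_cong n" "(y2, z2) \<in> braid_cong n"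
    then have "(y1 @ y2, z1 @ z2) \<in> braid_cong n" by (rule braid_cong_append)
    then show "braid_cong n `` {y1 @ y2} = braid_cong n `` {z1 @ z2}"
      by (rule equiv_class_eq[OF equiv_braid_cong])
  qed
  from UN_equiv_class2[OF equiv_braid_cong equiv_braid_cong this assms]
  show ?thesis by (simp add: braid_monoid_def)
qed

lemma monoid_braid_monoid: "monoid (braid_monoid n)"
proof (rule monoidI)
  fix x y assume "x \<in> carrier (braid_monoid n)" "y \<in> carrier (braid_monoid n)"
  then show "x \<otimes>\<^bsub>braid_monoid n\<^esub> y \<in> carrier (braid_monoid n)"
    by (elim braid_carrierE) (simp add: braid_mult_class braid_class_in_carrier)
next
  show "\<one>\<^bsub>braid_monoid n\<^esub> \<in> carrier (braid_monoid n)"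
    by (simp add: braid_one braid_class_in_carrier)
next
  fix x y z
  assume "x \<in> carrier (braid_monoid n)" "y \<in> carrier (braid_monoid n)"
    "z \<in> carrier (braid_monoid n)"
  then show "x \<otimes>\<^bsub>braid_monoid n\<^esub> y \<otimes>\<^bsub>braid_monoid n\<^esub> z =
      x \<otimes>\<^bsub>braid_monoid n\<^esub> (y \<otimes>\<^bsub>braid_monoid n\<^esub> z)"
    by (elim braid_carrierE) (simp add: braid_mult_class)
next
  fix x assume "x \<in> carrier (braid_monoid n)"
  then show "\<one>\<^bsub>braid_monoid n\<^esub> \<otimes>\<^bsub>braid_monoid n\<^esub> x = x"
    by (elim braid_carrierE) (simp add: braid_one braid_mult_class)
next
  fix x assume "x \<in> carrier (braid_monoid n)"
  then show "x \<otimes>\<^bsub>braid_monoid n\<^esub> \<one>\<^bsub>braid_monoid n\<^esub> = x"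
    by (elim braid_carrierE) (simp add: braid_one braid_mult_class)
qed

lemma anti_involution_class_rev:
  assumes f: "anti_involution (braid_monoid n) f"
    and gen: "\<forall>i\<in>{1..n}. f (braid_gen n i) = braid_gen n i"
    and "w \<in> lists {1..n}"
  shows "f (braid_cong n `` {w}) = braid_cong n `` {rev w}"
  using assms(3)
proof (induction w)
  case Nil
  then show ?case using f by (simp add: anti_involution_def braid_one)
next
  case (Cons i w)
  then have i: "i \<in> {1..n}" and w: "w \<in> lists {1..n}" by auto
  have "braid_cong n `` {i # w} = braid_gen n i \<otimes>\<^bsub>braid_monoid n\<^esub> braid_cong n `` {w}"
    using braid_mult_class[of "[i]" n w] i w by (simp add: braid_gen_def)
  moreover have "braid_gen n i \<in> carrier (braid_monoid n)"
    using i by (simp add: braid_gen_def braid_class_in_carrier)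
  ultimately have "f (braid_cong n `` {i # w}) =
      f (braid_cong n `` {w}) \<otimes>\<^bsub>braid_monoid n\<^esub> f (braid_gen n i)"
    using f braid_class_in_carrier[OF w] by (simp add: anti_involution_def)
  also have "\<dots> = braid_cong n `` {rev w} \<otimes>\<^bsub>braid_monoid n\<^esub> braid_cong n `` {[i]}"
    using gen i Cons.IH w by (simp add: braid_gen_def)
  also have "\<dots> = braid_cong n `` {rev w @ [i]}"
    using i w by (intro braid_mult_class) auto
  finally show ?case by simp
qed

lemma ex1_braid_op:
  "\<exists>!f. f \<in> extensional (carrier (braid_monoid n)) \<and>
     anti_involution (braid_monoid n) f \<and> (\<forall>i\<in>{1..n}. f (braid_gen n i) = braid_gen n i)"
proof (rule ex_ex1I)
  define F where
    "F = restrict (\<lambda>X. \<Union>x\<in>X. braid_cong n `` {rev x}) (carrier (braid_monoid n))"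
  have F: "F (braid_cong n `` {w}) = braid_cong n `` {rev w}" if w: "w \<in> lists {1..n}" for w
  proof -
    have "congruent (braid_cong n) (\<lambda>x. braid_cong n `` {rev x})"
      by (rule congruentI) (rule equiv_class_eq[OF equiv_braid_cong braid_cong_rev])
    from UN_equiv_class[OF equiv_braid_cong this w] show ?thesis
      by (simp add: F_def braid_class_in_carrier[OF w])
  qed
  have r: "rev w \<in> lists {1..n}" if "w \<in> lists {1..n}" for w :: "nat list"
    using that by auto
  have "anti_involution (braid_monoid n) F"
    unfolding anti_involution_def
  proof (intro conjI ballI funcsetI)
    fix x assume "x \<in> carrier (braid_monoid n)"
    then show "F x \<in> carrier (braid_monoid n)"
      by (elim braid_carrierE) (metis F r braid_class_in_carrier)
  next
    show "F \<one>\<^bsub>braid_monoid n\<^esub> = \<one>\<^bsub>braid_monoid n\<^esub>"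
      by (simp add: braid_one F)
  next
    fix x y assume "x \<in> carrier (braid_monoid n)" "y \<in> carrier (braid_monoid n)"
    then obtain v w where vw: "v \<in> lists {1..n}" "x = braid_cong n `` {v}"
      "w \<in> lists {1..n}" "y = braid_cong n `` {w}"
      by (elim braid_carrierE)
    have "v @ w \<in> lists {1..n}" using vw by auto
    then show "F (x \<otimes>\<^bsub>braid_monoid n\<^esub> y) = F y \<otimes>\<^bsub>braid_monoid n\<^esub> F x"
      using vw by (simp only: braid_mult_class F r rev_append)
  next
    fix x assume "x \<in> carrier (braid_monoid n)"
    then show "F (F x) = x"
      by (elim braid_carrierE) (metis F r rev_rev_ident)
  qed
  moreover have "\<forall>i\<in>{1..n}. F (braid_gen n i) = braid_gen n i"
    by (simp add: braid_gen_def F)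
  ultimately show "\<exists>f. f \<in> extensional (carrier (braid_monoid n)) \<and>
     anti_involution (braid_monoid n) f \<and> (\<forall>i\<in>{1..n}. f (braid_gen n i) = braid_gen n i)"
    by (intro exI[of _ F]) (simp add: F_def)
next
  fix f g
  assume f: "f \<in> extensional (carrier (braid_monoid n)) \<and>
     anti_involution (braid_monoid n) f \<and> (\<forall>i\<in>{1..n}. f (braid_gen n i) = braid_gen n i)"
    and g: "g \<in> extensional (carrier (braid_monoid n)) \<and>
     anti_involution (braid_monoid n) g \<and> (\<forall>i\<in>{1..n}. g (braid_gen n i) = braid_gen n i)"
  show "f = g"
  proof (rule extensionalityI)
    show "f \<in> extensional (carrier (braid_monoid n))" using f by blast
    show "g \<in> extensional (carrier (braid_monoid n))" using g by blast
    fix x assume "x \<in> carrier (braid_monoid n)"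
    then show "f x = g x"
      using f g by (elim braid_carrierE) (metis anti_involution_class_rev)
  qed
qed

lemma braid_op_anti_involution:
  "anti_involution (braid_monoid n) (braid_op n)"
  "i \<in> {1..n} \<Longrightarrow> braid_op n (braid_gen n i) = braid_gen n i"
  using theI'[OF ex1_braid_op[of n]] unfolding braid_op_def by blast+

lemma braid_op_class:
  "w \<in> lists {1..n} \<Longrightarrow> braid_op n (braid_cong n `` {w}) = braid_cong n `` {rev w}"
  using anti_involution_class_rev braid_op_anti_involution by blast

lemma ordered_prod_braid_gen:
  "w \<in> lists {1..n} \<Longrightarrow>
     ordered_prod (braid_monoid n) (map (braid_gen n) w) = braid_cong n `` {w}"
proof (induction w)
  case Nil
  then show ?case by (simp add: ordered_prod_def braid_one)
next
  case (Cons i w)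
  then show ?case using braid_mult_class[of "[i]" n w]
    by (simp add: ordered_prod_def braid_gen_def)
qed

lemma braid_transp_class:
  assumes "1 \<le> i" "i < j" "j \<le> n + 1"
  shows "braid_transp n i j = braid_cong n `` {[i..<j] @ rev [i..<j - 1]}"
  unfolding braid_transp_def by (rule ordered_prod_braid_gen) (use assms in auto)

lemma far_letter_commute:
  assumes "w \<in> lists {1..n}" "i \<in> {1..n}" "\<forall>j\<in>set w. \<bar>int i - int j\<bar> > 1"
  shows "(i # w, w @ [i]) \<in> braid_cong n"
  using assms
proof (induction w)
  case Nil
  then show ?case using braid_cong.refl[of "[i]" n] by simp
next
  case (Cons j w)
  have "(i # j # w, j # i # w) \<in> braid_cong n"
    using braid_cong.far[of "[]" n w i j] Cons.hyps Cons.prems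
    by (simp add: in_lists_conv_set)
  moreover have "(j # i # w, j # w @ [i]) \<in> braid_cong n"
    using braid_cong_context[of "i # w" "w @ [i]" n "[j]" "[]"] Cons by simp
  ultimately show ?case by (simp add: braid_cong.trans)
qed

lemma far_words_commute:
  assumes "v \<in> lists {1..n}" "w \<in> lists {1..n}"
    "\<forall>i\<in>set v. \<forall>j\<in>set w. \<bar>int i - int j\<bar> > 1"
  shows "(v @ w, w @ v) \<in> braid_cong n"
  using assms
proof (induction v)
  case Nil
  then show ?case by (simp add: braid_cong.refl)
next
  case (Cons i v)
  have "(i # v @ w, i # w @ v) \<in> braid_cong n"
    using braid_cong_context[of "v @ w" "w @ v" n "[i]" "[]"] Cons
    by (simp add: in_lists_conv_set)
  moreover have "(i # w @ v, w @ i # v) \<in> braid_cong n"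
    using braid_cong_context[of "i # w" "w @ [i]" n "[]" v] far_letter_commute[of w n i]
      Cons.hyps Cons.prems by (simp add: in_lists_conv_set)
  ultimately show ?case by (simp add: braid_cong.trans)
qed

lemma braid_transp_commute:
  assumes "1 \<le> i" "i < j" "j < k" "k < l" "l \<le> n + 1"
  shows "braid_transp n i j \<otimes>\<^bsub>braid_monoid n\<^esub> braid_transp n k l =
    braid_transp n k l \<otimes>\<^bsub>braid_monoid n\<^esub> braid_transp n i j"
proof -
  define v w where "v = [i..<j] @ rev [i..<j - 1]" and "w = [k..<l] @ rev [k..<l - 1]"
  have v: "v \<in> lists {1..n}" and w: "w \<in> lists {1..n}"
    using assms by (auto simp: v_def w_def)
  have "(v @ w, w @ v) \<in> braid_cong n"
    using v w by (rule far_words_commute) (use assms in \<open>auto simp: v_def w_def\<close>)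
  moreover have "braid_transp n i j = braid_cong n `` {v}"
    "braid_transp n k l = braid_cong n `` {w}"
    using assms by (simp_all add: braid_transp_class v_def w_def)
  ultimately show ?thesis
    using v w by (simp add: braid_mult_class equiv_class_eq[OF equiv_braid_cong])
qed

end

theory Submission
  imports Defs
begin

text \<open>Colour strands by elements of the dihedral quandle \<open>x \<triangleright> y = 2 y - x\<close> on the integers (Fox
  colourings), or leave them transparent. Self-distributivity makes this an action of the braid
  monoid on colourings of the positions. Colour one strand in each of two gaps, \<open>p\<close> left of \<open>q\<close>, and a
  single strand \<open>z\<close> of \<open>J\<close> starting between them. All crossings among strands of \<open>J\<close> become
  invisible, and under the alternating product of \<open>tau1\<close> and \<open>tau0\<close> the strand \<open>z\<close> sweeps along
  \<open>J\<close>, bouncing off both ends, and so winds alternately around \<open>p\<close> and \<open>q\<close>. Whether it goes around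
  \<open>p\<close> or \<open>q\<close> first is decided by the order of \<open>tau1\<close> and \<open>tau0\<close>, which \<open>op\<close> exchanges. On the
  colours \<open>(p, z, q) = (0, 1, 2)\<close> the order \<open>p\<close>, \<open>q\<close> acts with finite order, whereas the order
  \<open>q\<close>, \<open>p\<close> makes the colours drift off linearly, so no common power of the two can agree.\<close>

section \<open>Quandle colourings and the action of braid words on them\<close>

fun rack :: "int option \<Rightarrow> int option \<Rightarrow> int option" where
  "rack (Some x) (Some y) = Some (2 * y - x)"
| "rack x None = x"
| "rack None y = None"

lemma rack_None [simp]: "rack None y = None"
  by (cases y) auto

text \<open>With three colours both sides are \<open>2 * z - 2 * y + x\<close>; \<open>None\<close>
  acts as the identity and is fixed by every action, so adjoining it to the dihedral quandle does no
  harm.\<close>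

lemma rack_distrib: "rack (rack x y) z = rack (rack x z) (rack y z)"
  by (cases x; cases y; cases z) auto

text \<open>The strand moving from \<open>Suc i\<close> to \<open>i\<close> passes over: it keeps
  its colour and acts on the strand it crosses.\<close>

definition cross :: "nat \<Rightarrow> (nat \<Rightarrow> int option) \<Rightarrow> nat \<Rightarrow> int option" where
  "cross i f = f(i := f (Suc i), Suc i := rack (f i) (f (Suc i)))"

lemma cross_far:
  assumes "\<bar>int i - int j\<bar> > 1"
  shows "cross i (cross j f) = cross j (cross i f)"
  using assms by (auto simp: cross_def fun_eq_iff)

text \<open>This is the third Reidemeister move; the two sides could differ only at the rightmost of
  the three positions, where self-distributivity identifies them.\<close>

lemma cross_near_Suc:
  "cross i (cross (Suc i) (cross i f)) = cross (Suc i) (cross i (cross (Suc i) f))"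
  by (auto simp: cross_def fun_eq_iff rack_distrib[of "f i" "f (Suc i)" "f (Suc (Suc i))"])

lemma cross_near:
  assumes "\<bar>int i - int j\<bar> = 1"
  shows "cross i (cross j (cross i f)) = cross j (cross i (cross j f))"
proof -
  from assms have "j = Suc i \<or> i = Suc j" by auto
  then show ?thesis using cross_near_Suc by auto
qed

text \<open>The invariant of the proof: words that act differently on some colouring represent
  different braids.\<close>

lemma fold_cross_cong: "(v, w) \<in> braid_cong n \<Longrightarrow> fold cross v f = fold cross w f"
proof (induction arbitrary: f rule: braid_cong.induct)
  case (far u v i j)
  then show ?case by (simp add: cross_far)
next
  case (near u v i j)
  then show ?case by (simp add: cross_near)
qed simp_all

section \<open>Action of the square free lifts of transpositions\<close>

definition transp_word :: "nat \<Rightarrow> nat \<Rightarrow> nat list" where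
  "transp_word i j = [i..<j] @ rev [i..<j - 1]"

lemma rev_transp_word:
  assumes "i < j"
  shows "rev (transp_word i j) = transp_word i j"
proof -
  obtain l where "j = Suc l" "i \<le> l" using assms by (cases j) auto
  then show ?thesis by (simp add: transp_word_def)
qed

text \<open>The strand from \<open>i\<close> is carried right to \<open>j\<close>; every strand it
  meets acts on it in turn and shifts one place left unchanged.\<close>

lemma fold_cross_upt:
  "i \<le> j \<Longrightarrow> fold cross [i..<j] f =
    (\<lambda>s. if i \<le> s \<and> s < j then f (Suc s)
         else if s = j then foldl rack (f i) (map f [Suc i..<Suc j]) else f s)"
proof (induction j rule: dec_induct)
  case base
  show ?case by (auto simp: fun_eq_iff)
next
  case (step j)
  then show ?case by (auto simp: cross_def fun_eq_iff)
qed

text \<open>The strand from \<open>j\<close> is carried left to \<open>i\<close>, acts on every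
  strand it meets and shifts each one place right.\<close>

lemma fold_cross_rev_upt:
  "i \<le> j \<Longrightarrow> fold cross (rev [i..<j]) f =
    (\<lambda>s. if s = i then f j else if i < s \<and> s \<le> j then rack (f (s - 1)) (f j) else f s)"
proof (induction j arbitrary: f rule: dec_induct)
  case base
  then show ?case by auto
next
  case (step j)
  then show ?case by (auto simp: cross_def fun_eq_iff not_less le_Suc_eq)
qed

text \<open>The first half takes the strand at \<open>i\<close> to \<open>j\<close> and leaves the
  one from \<open>j\<close> at \<open>j - 1\<close>; the second half takes the latter back to
  \<open>i\<close>, acting on the strands between, which return to their places.\<close>

lemma fold_cross_transp_word:
  assumes "i < j"
  shows "fold cross (transp_word i j) f =
    (\<lambda>s. if s = i then f j
         else if s = j then foldl rack (f i) (map f [Suc i..<Suc j])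
         else if i < s \<and> s < j then rack (f s) (f j) else f s)"
proof -
  obtain l where l: "j = Suc l" "i \<le> l" using assms by (cases j) auto
  show ?thesis
    using l unfolding l(1) transp_word_def diff_Suc_1 fold_append o_apply
      fold_cross_rev_upt[OF l(2)] fold_cross_upt[OF le_SucI[OF l(2)]]
    by (auto simp: fun_eq_iff simp del: upt_Suc)
qed

lemma foldl_rack_None [simp]: "foldl rack None xs = None"
  by (induction xs) auto

lemma foldl_rack_transparent:
  "\<forall>s\<in>set xs. f s = None \<Longrightarrow> foldl rack c (map f xs) = c"
  by (induction xs) auto

lemma foldl_rack_single:
  assumes "p \<in> set xs" "distinct xs" "\<forall>s\<in>set xs. s \<noteq> p \<longrightarrow> f s = None"
  shows "foldl rack c (map f xs) = rack c (f p)"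
  using assms
proof (induction xs)
  case (Cons s xs)
  show ?case
  proof (cases "s = p")
    case True
    then have "\<forall>t\<in>set xs. f t = None" using Cons.prems by auto
    then show ?thesis using True by (simp add: foldl_rack_transparent)
  next
    case False
    then show ?thesis using Cons by simp
  qed
qed simp

section \<open>Tracking one strand of \<open>J\<close> past two coloured gap strands\<close>

text \<open>\<open>(r, x, y, w)\<close>: the strand \<open>z\<close> sits at the \<open>r\<close>-th element of \<open>J\<close>, and \<open>p\<close>, \<open>z\<close>, \<open>q\<close> have colours
  \<open>x\<close>, \<open>y\<close>, \<open>w\<close>.\<close>

type_synonym tracked = "nat \<times> int \<times> int \<times> int"

text \<open>\<open>pos\<close> enumerates \<open>J\<close>, \<open>k\<close> is its size, and
  \<open>p\<close>, \<open>q\<close> are positions missing from \<open>J\<close>, one in the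
  \<open>a\<close>-th and one in the \<open>b\<close>-th interval. The place \<open>Suc a\<close>
  thus lies between them.\<close>

locale two_gaps =
  fixes pos :: "nat \<Rightarrow> nat" and k a b p q :: nat
  assumes pos_less: "1 \<le> r \<Longrightarrow> r < s \<Longrightarrow> s \<le> k \<Longrightarrow> pos r < pos s"
    and ab: "1 \<le> a" "a < b" "b < k"
    and p: "pos a < p" "p < pos (Suc a)"
    and q: "pos b < q" "q < pos (Suc b)"
begin

definition coloring :: "tracked \<Rightarrow> nat \<Rightarrow> int option" where
  "coloring = (\<lambda>(r, x, y, w). (\<lambda>_. None)(p := Some x, q := Some w, pos r := Some y))"

text \<open>The strand carried right is the one acted on, so a gap changes the colour of
  \<open>z\<close>; in \<open>left\<close> the strand \<open>z\<close> is carried back over the gap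
  strand and changes its colour instead.\<close>

fun right :: "tracked \<Rightarrow> tracked" where
  "right (r, x, y, w) = (Suc r, x, if r = a then 2 * x - y else if r = b then 2 * w - y else y, w)"

fun left :: "tracked \<Rightarrow> tracked" where
  "left (r, x, y, w) =
    (r - 1, if r = Suc a then 2 * y - x else x, y, if r = Suc b then 2 * y - w else w)"

lemma pos_le: "1 \<le> r \<Longrightarrow> r \<le> s \<Longrightarrow> s \<le> k \<Longrightarrow> pos r \<le> pos s"
  using pos_less[of r s] by (cases "r = s") simp_all

lemma pos_eq_iff:
  assumes "1 \<le> r" "r \<le> k" "1 \<le> s" "s \<le> k"
  shows "pos r = pos s \<longleftrightarrow> r = s"
proof (cases r s rule: linorder_cases)
  case less
  then show ?thesis using pos_less[of r s] assms by simp
next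
  case greater
  then show ?thesis using pos_less[of s r] assms by simp
qed simp

lemma gap_less_iff:
  assumes t: "1 \<le> t" "t < k" "pos t < c" "c < pos (Suc t)" and r: "1 \<le> r" "r \<le> k"
  shows "c < pos r \<longleftrightarrow> t < r" "pos r < c \<longleftrightarrow> r \<le> t"
proof -
  have "pos r \<le> pos t" if "r \<le> t" using pos_le[of r t] r t that by simp
  moreover have "pos (Suc t) \<le> pos r" if "t < r" using pos_le[of "Suc t" r] r that by simp
  ultimately show "c < pos r \<longleftrightarrow> t < r" "pos r < c \<longleftrightarrow> r \<le> t"
    using t by (cases "r \<le> t"; simp)+
qed

lemma p_less_iff: "1 \<le> r \<Longrightarrow> r \<le> k \<Longrightarrow> p < pos r \<longleftrightarrow> a < r"
  and less_p_iff: "1 \<le> r \<Longrightarrow> r \<le> k \<Longrightarrow> pos r < p \<longleftrightarrow> r \<le> a"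
  using gap_less_iff[of a p r] p ab by simp_all

lemma q_less_iff: "1 \<le> r \<Longrightarrow> r \<le> k \<Longrightarrow> q < pos r \<longleftrightarrow> b < r"
  and less_q_iff: "1 \<le> r \<Longrightarrow> r \<le> k \<Longrightarrow> pos r < q \<longleftrightarrow> r \<le> b"
  using gap_less_iff[of b q r] q ab by simp_all

lemma pos_neq:
  assumes "1 \<le> r" "r \<le> k" shows "pos r \<noteq> p" "pos r \<noteq> q"
  using less_p_iff[OF assms] p_less_iff[OF assms] less_q_iff[OF assms] q_less_iff[OF assms]
  by linarith+

lemma between_iff:
  assumes "1 \<le> r" "r < k"
  shows "pos r < p \<and> p < pos (Suc r) \<longleftrightarrow> r = a" "pos r < q \<and> q < pos (Suc r) \<longleftrightarrow> r = b"
  using assms less_p_iff[of r] p_less_iff[of "Suc r"] less_q_iff[of r] q_less_iff[of "Suc r"]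
  by (simp_all add: less_Suc_eq_le eq_iff)

lemma p_less_q: "p < q"
  using p q pos_le[of "Suc a" b] ab by simp

lemma coloring_simps:
  "coloring (r, x, y, w) s =
    (if s = pos r then Some y else if s = q then Some w else if s = p then Some x else None)"
  by (simp add: coloring_def)

definition adj_word :: "nat \<Rightarrow> nat list" where
  "adj_word r = transp_word (pos r) (pos (Suc r))"

text \<open>As \<open>a\<close> and \<open>b\<close> differ, an interval contains at most one of
  \<open>p\<close>, \<open>q\<close>, and the endpoint \<open>pos (Suc r)\<close> is transparent, so
  at most one action survives.\<close>

lemma foldl_rack_gap:
  assumes "1 \<le> r" "r < k"
  shows "foldl rack c (map (coloring (r, x, y, w)) [Suc (pos r)..<Suc (pos (Suc r))]) =
    (if r = a then rack c (Some x) else if r = b then rack c (Some w) else c)"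
proof -
  let ?xs = "[Suc (pos r)..<Suc (pos (Suc r))]"
  have mem: "t \<in> set ?xs \<longleftrightarrow> pos r < t \<and> t < pos (Suc r)" if "pos (Suc r) \<noteq> t" for t
    using that unfolding set_upt by auto
  have pin: "p \<in> set ?xs \<longleftrightarrow> r = a" and qin: "q \<in> set ?xs \<longleftrightarrow> r = b"
    using mem between_iff[OF assms] assms pos_neq[of "Suc r"] by (simp_all del: set_upt upt_Suc)
  have out: "coloring (r, x, y, w) s = None" if "s \<in> set ?xs" "s \<noteq> p" "s \<noteq> q" for s
    using that by (auto simp: coloring_simps)
  consider "r = a" | "r = b" "r \<noteq> a" | "r \<noteq> a" "r \<noteq> b" by blast
  then show ?thesis
  proof cases
    case 1
    then have "q \<notin> set ?xs" "p \<in> set ?xs" using pin qin ab by blast+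
    then have "foldl rack c (map (coloring (r, x, y, w)) ?xs) = rack c (coloring (r, x, y, w) p)"
      using out by (intro foldl_rack_single distinct_upt) blast+
    then show ?thesis using 1 pos_neq[of r] assms p_less_q by (simp add: coloring_simps)
  next
    case 2
    then have "p \<notin> set ?xs" "q \<in> set ?xs" using pin qin by blast+
    then have "foldl rack c (map (coloring (r, x, y, w)) ?xs) = rack c (coloring (r, x, y, w) q)"
      using out by (intro foldl_rack_single distinct_upt) blast+
    then show ?thesis using 2 pos_neq[of r] assms p_less_q by (simp add: coloring_simps)
  next
    case 3
    then have "\<forall>s\<in>set ?xs. coloring (r, x, y, w) s = None" using pin qin out by blast
    from foldl_rack_transparent[OF this] show ?thesis using 3 by simp
  qed
qed

text \<open>The strand that travels back is transparent, so only the passage of \<open>z\<close>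
  through the gap is seen.\<close>

lemma adj_word_right:
  assumes "1 \<le> r" "r < k"
  shows "fold cross (adj_word r) (coloring (r, x, y, w)) = coloring (right (r, x, y, w))"
proof
  fix s
  have lt: "pos r < pos (Suc r)" using pos_less[of r "Suc r"] assms by simp
  have ne: "pos r \<noteq> p" "pos r \<noteq> q" "pos (Suc r) \<noteq> p" "pos (Suc r) \<noteq> q"
    using pos_neq[of r] pos_neq[of "Suc r"] assms by auto
  show "fold cross (adj_word r) (coloring (r, x, y, w)) s = coloring (right (r, x, y, w)) s"
    unfolding adj_word_def fold_cross_transp_word[OF lt] foldl_rack_gap[OF assms]
    using lt ne p_less_q by (auto simp: coloring_simps)
qed

text \<open>Here the outward strand is transparent, and \<open>z\<close> acts on the gap strand on
  the way back.\<close>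

lemma adj_word_left:
  assumes "1 \<le> r" "r < k"
  shows "fold cross (adj_word r) (coloring (Suc r, x, y, w)) = coloring (left (Suc r, x, y, w))"
proof
  fix s
  have lt: "pos r < pos (Suc r)" using pos_less[of r "Suc r"] assms by simp
  have ne: "pos r \<noteq> p" "pos r \<noteq> q" "pos (Suc r) \<noteq> p" "pos (Suc r) \<noteq> q"
    using pos_neq[of r] pos_neq[of "Suc r"] assms by auto
  have "coloring (Suc r, x, y, w) (pos r) = None"
    using lt ne by (simp add: coloring_simps)
  then show "fold cross (adj_word r) (coloring (Suc r, x, y, w)) s = coloring (left (Suc r, x, y, w)) s"
    unfolding adj_word_def fold_cross_transp_word[OF lt]
    using lt ne p_less_q by (auto simp: coloring_simps between_iff[OF assms, symmetric])
qed

text \<open>Both exchanged strands are transparent and the strands between return to their places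
  unaltered.\<close>

lemma adj_word_idle:
  assumes "1 \<le> r" "r < k" "1 \<le> s" "s \<le> k" "s \<noteq> r" "s \<noteq> Suc r"
  shows "fold cross (adj_word r) (coloring (s, x, y, w)) = coloring (s, x, y, w)"
proof
  fix t
  have lt: "pos r < pos (Suc r)" using pos_less[of r "Suc r"] assms by simp
  have ne: "pos r \<noteq> p" "pos r \<noteq> q" "pos (Suc r) \<noteq> p" "pos (Suc r) \<noteq> q"
    using pos_neq[of r] pos_neq[of "Suc r"] assms by auto
  have "pos r \<noteq> pos s" "pos (Suc r) \<noteq> pos s"
    using assms pos_eq_iff[of r s] pos_eq_iff[of "Suc r" s] by auto
  then have "coloring (s, x, y, w) (pos r) = None" "coloring (s, x, y, w) (pos (Suc r)) = None"
    using ne by (simp_all add: coloring_simps)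
  then show "fold cross (adj_word r) (coloring (s, x, y, w)) t = coloring (s, x, y, w) t"
    unfolding adj_word_def fold_cross_transp_word[OF lt] by simp
qed

section \<open>The factors \<open>tau1\<close> and \<open>tau0\<close> as half-steps of
  \<open>z\<close>\<close>

definition brick_word :: "nat list \<Rightarrow> nat list" where
  "brick_word rs = concat (map adj_word rs)"

text \<open>\<open>z\<close> is moving right when \<open>e + r\<close> is even and left otherwise; each half-step raises \<open>e\<close> by one, so the
  direction persists while \<open>z\<close> moves and flips when it rests at an end.\<close>

fun half_step :: "nat \<Rightarrow> tracked \<Rightarrow> tracked" where
  "half_step e (r, x, y, w) =
    (if even (e + r) then (if r < k then right (r, x, y, w) else (r, x, y, w))
     else if 1 < r then left (r, x, y, w) else (r, x, y, w))"

text \<open>Odd \<open>e\<close> gives the indices of \<open>tau1\<close>, even \<open>e\<close>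
  those of \<open>tau0\<close>. Their order is left free so that reversed products are covered as
  well.\<close>

definition bricks :: "nat \<Rightarrow> nat list \<Rightarrow> bool" where
  "bricks e rs \<longleftrightarrow> distinct rs \<and> set rs = {r. 1 \<le> r \<and> r < k \<and> even (e + r)}"

lemma brick_word_idle:
  assumes "\<forall>r\<in>set rs. 1 \<le> r \<and> r < k \<and> r \<noteq> s \<and> Suc r \<noteq> s" "1 \<le> s" "s \<le> k"
  shows "fold cross (brick_word rs) (coloring (s, x, y, w)) = coloring (s, x, y, w)"
  using assms
proof (induction rs)
  case (Cons r rs)
  then show ?case by (auto simp: brick_word_def adj_word_idle)
qed (simp add: brick_word_def)

lemma half_step_range:
  assumes "1 \<le> fst u" "fst u \<le> k"
  shows "1 \<le> fst (half_step e u)" "fst (half_step e u) \<le> k"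
proof -
  obtain r x y w where u: "u = (r, x, y, w)" by (cases u) auto
  have "1 \<le> fst (half_step e u) \<and> fst (half_step e u) \<le> k"
    using assms unfolding u half_step.simps right.simps left.simps by (simp only: split: if_split) force
  then show "1 \<le> fst (half_step e u)" "fst (half_step e u) \<le> k" by blast+
qed

text \<open>The indices share their parity, so no two are adjacent and at most one factor moves
  \<open>z\<close>: the one at \<open>s\<close> to the right or the one at \<open>s - 1\<close> to
  the left. All others are idle.\<close>

lemma brick_word_half_step:
  assumes rs: "bricks e rs" and s: "1 \<le> fst u" "fst u \<le> k"
  shows "fold cross (brick_word rs) (coloring u) = coloring (half_step e u)"
proof -
  obtain s x y w where u: "u = (s, x, y, w)" by (cases u) auto
  have s: "1 \<le> s" "s \<le> k" using s u by auto
  have set: "set rs = {r. 1 \<le> r \<and> r < k \<and> even (e + r)}" and dist: "distinct rs"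
    using rs by (auto simp: bricks_def)
  consider "s \<in> set rs" | t where "s = Suc t" "t \<in> set rs"
    | "\<forall>r\<in>set rs. r \<noteq> s \<and> Suc r \<noteq> s"
    by blast
  then show ?thesis
  proof cases
    case 1
    then obtain us vs where rs: "rs = us @ s # vs" by (auto simp: in_set_conv_decomp)
    have other: "1 \<le> r \<and> r < k \<and> r \<noteq> s \<and> Suc r \<noteq> s \<and> r \<noteq> Suc s"
      if "r \<in> set us \<union> set vs" for r
    proof -
      have "r \<in> set rs" "r \<noteq> s" using that rs dist by auto
      then have "1 \<le> r \<and> r < k" "even (e + r)" "even (e + s)" "r \<noteq> s" using set 1 by blast+
      then show ?thesis by presburger
    qed
    have sk: "s < k" "even (e + s)" using 1 set by blast+
    have "fold cross (brick_word us) (coloring (s, x, y, w)) = coloring (s, x, y, w)"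
      by (rule brick_word_idle) (use other s in auto)
    moreover have "fold cross (brick_word vs) (coloring (right (s, x, y, w))) =
        coloring (right (s, x, y, w))"
      unfolding right.simps by (rule brick_word_idle) (use other s sk in auto)
    moreover have "brick_word rs = brick_word us @ adj_word s @ brick_word vs"
      by (simp add: rs brick_word_def)
    ultimately show ?thesis using s sk adj_word_right[of s x y w] u by simp
  next
    case t: 2
    then obtain us vs where rs: "rs = us @ t # vs" by (auto simp: in_set_conv_decomp)
    have other: "1 \<le> r \<and> r < k \<and> r \<noteq> s \<and> Suc r \<noteq> s \<and> Suc r \<noteq> t"
      if "r \<in> set us \<union> set vs" for r
    proof -
      have "r \<in> set rs" "r \<noteq> t" using that rs dist by auto
      then have "1 \<le> r \<and> r < k" "even (e + r)" "even (e + t)" "r \<noteq> t" using set t by blast+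
      then show ?thesis using t(1) by presburger
    qed
    have "even (e + t)" using set t by blast
    then have tk: "1 \<le> t" "t < k" "odd (e + s)" using set t by auto
    have "fold cross (brick_word us) (coloring (s, x, y, w)) = coloring (s, x, y, w)"
      by (rule brick_word_idle) (use other s in auto)
    moreover have "fold cross (brick_word vs) (coloring (left (s, x, y, w))) =
        coloring (left (s, x, y, w))"
      unfolding left.simps by (rule brick_word_idle) (use other t tk in auto)
    moreover have "brick_word rs = brick_word us @ adj_word t @ brick_word vs"
      by (simp add: rs brick_word_def)
    ultimately show ?thesis using t tk adj_word_left[of t x y w] u by simp
  next
    case 3
    then have "fold cross (brick_word rs) (coloring (s, x, y, w)) = coloring (s, x, y, w)"
      by (intro brick_word_idle) (use s set in auto)
    \<comment> \<open>No factor touches \<open>z\<close> only if it heads right at \<open>k\<close>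
      or left at 1, where \<open>half_step\<close> rests.\<close>
    moreover have "half_step e u = u"
    proof (cases "even (e + s)")
      case True
      then have "\<not> s < k" using 3 set s by blast
      then show ?thesis using u True by simp
    next
      case False
      have "\<not> 1 < s"
      proof
        assume "1 < s"
        then obtain t where "s = Suc t" "1 \<le> t" by (cases s) auto
        moreover from this have "t < k" "even (e + t)" using s False by auto
        ultimately show False using 3 set by blast
      qed
      then show ?thesis using u False by simp
    qed
    ultimately show ?thesis using u by simp
  qed
qed

section \<open>Path and colours of \<open>z\<close> under alternating half-steps\<close>

fun run :: "nat \<Rightarrow> nat \<Rightarrow> tracked \<Rightarrow> tracked" where
  "run e 0 u = u"
| "run e (Suc n) u = run (Suc e) n (half_step e u)"

lemma run_add: "run e (m + n) u = run (e + m) n (run e m u)"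
  by (induction m arbitrary: e u) auto

lemma half_step_parity: "even e = even e' \<Longrightarrow> half_step e u = half_step e' u"
  by (cases u) auto

lemma run_parity: "even e = even e' \<Longrightarrow> run e n u = run e' n u"
proof (induction n arbitrary: e e' u)
  case (Suc n)
  then show ?case using half_step_parity[of e e' u] Suc.IH[of "Suc e" "Suc e'"] by simp
qed simp

text \<open>In this and the next three straight runs \<open>e\<close> rises by one while
  \<open>r\<close> changes by one, so the parity of \<open>e + r\<close>, and with it the direction,
  persists. The bounds keep \<open>z\<close> on one side of the other gap, so at most one crossing
  has an effect.\<close>

lemma run_right_q:
  assumes "even (e + r)" "a < r" "r + n \<le> k"
  shows "run e n (r, x, y, w) = (r + n, x, if r \<le> b \<and> b < r + n then 2 * w - y else y, w)"
  using assms
proof (induction n arbitrary: e r y)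
  case (Suc n)
  have "run (Suc e) n (Suc r, x, y', w) =
      (Suc r + n, x, if Suc r \<le> b \<and> b < Suc r + n then 2 * w - y' else y', w)" for y'
    using Suc.prems by (intro Suc.IH) auto
  then show ?case using Suc.prems ab by auto
qed simp

lemma run_left_q:
  assumes "odd (e + r)" "a + n < r" "r \<le> k"
  shows "run e n (r, x, y, w) = (r - n, x, y, if r - n \<le> b \<and> b < r then 2 * y - w else w)"
  using assms
proof (induction n arbitrary: e r w)
  case (Suc n)
  then obtain t where t: "r = Suc t" by (cases r) auto
  have "run (Suc e) n (t, x, y, w') =
      (t - n, x, y, if t - n \<le> b \<and> b < t then 2 * y - w' else w')" for w'
    using Suc.prems t by (intro Suc.IH) auto
  then show ?case using Suc.prems ab t by auto
qed simp

lemma run_left_p: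
  assumes "odd (e + r)" "n < r" "r \<le> b"
  shows "run e n (r, x, y, w) = (r - n, if r - n \<le> a \<and> a < r then 2 * y - x else x, y, w)"
  using assms
proof (induction n arbitrary: e r x)
  case (Suc n)
  then obtain t where t: "r = Suc t" by (cases r) auto
  have "run (Suc e) n (t, x', y, w) =
      (t - n, if t - n \<le> a \<and> a < t then 2 * y - x' else x', y, w)" for x'
    using Suc.prems t by (intro Suc.IH) auto
  then show ?case using Suc.prems ab t by auto
qed simp

lemma run_right_p:
  assumes "even (e + r)" "1 \<le> r" "r + n \<le> b"
  shows "run e n (r, x, y, w) = (r + n, x, if r \<le> a \<and> a < r + n then 2 * x - y else y, w)"
  using assms
proof (induction n arbitrary: e r y)
  case (Suc n)
  have "run (Suc e) n (Suc r, x, y', w) =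
      (Suc r + n, x, if Suc r \<le> a \<and> a < Suc r + n then 2 * x - y' else y', w)" for y'
    using Suc.prems by (intro Suc.IH) auto
  then show ?case using Suc.prems ab by auto
qed simp

text \<open>\<open>k - a - 1\<close> moves each way plus one half-step resting at the end.\<close>

lemma run_excursion_q:
  assumes "odd (e + a)"
  shows "run e (2 * (k - a) - 1) (Suc a, x, y, w) = (Suc a, x, 2 * w - y, 3 * w - 2 * y)"
proof -
  define l where "l = k - Suc a"
  have l: "k = Suc a + l" "2 * (k - a) - 1 = l + (1 + l)" using ab by (auto simp: l_def)
  have "run e l (Suc a, x, y, w) = (k, x, 2 * w - y, w)"
    using assms l ab by (subst run_right_q) auto
  moreover have "even (e + l + k)" using assms unfolding l(1) by presburger
  then have "run (e + l) 1 (k, x, 2 * w - y, w) = (k, x, 2 * w - y, w)" by simp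
  moreover have "run (e + l + 1) l (k, x, 2 * w - y, w) = (Suc a, x, 2 * w - y, 3 * w - 2 * y)"
    using assms l ab by (subst run_left_q) auto
  ultimately show ?thesis unfolding l(2) run_add by simp
qed

text \<open>There are \<open>a\<close> moves each way and one rest at the left end. The gap is first
  met moving left, so \<open>z\<close> acts on \<open>p\<close> before \<open>p\<close> acts on
  \<open>z\<close>; around \<open>q\<close> the order is the reverse.\<close>

lemma run_excursion_p:
  assumes "even (e + a)"
  shows "run e (2 * a + 1) (Suc a, x, y, w) = (Suc a, 2 * y - x, 3 * y - 2 * x, w)"
proof -
  have l: "2 * a + 1 = a + (1 + a)" by simp
  have "run e a (Suc a, x, y, w) = (1, 2 * y - x, y, w)"
    using assms ab by (subst run_left_p) auto
  moreover have "run (e + a) 1 (1, 2 * y - x, y, w) = (1, 2 * y - x, y, w)"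
    using assms by auto
  moreover have "run (e + a + 1) a (1, 2 * y - x, y, w) = (Suc a, 2 * y - x, 3 * y - 2 * x, w)"
    using assms ab by (subst run_right_p) auto
  ultimately show ?thesis unfolding l run_add by simp
qed

text \<open>Each excursion has an odd number of half-steps and so flips the direction at
  \<open>Suc a\<close>. The two therefore alternate, and together they take \<open>2 * k\<close>
  half-steps.\<close>

lemma run_period_left:
  assumes "even (e + a)"
  shows "run e (2 * k) (Suc a, x, y, w) =
    (Suc a, 2 * y - x, 2 * w - (3 * y - 2 * x), 3 * w - 2 * (3 * y - 2 * x))"
proof -
  have "2 * k = (2 * a + 1) + (2 * (k - a) - 1)" using ab by simp
  then have "run e (2 * k) (Suc a, x, y, w) =
      run (e + (2 * a + 1)) (2 * (k - a) - 1) (run e (2 * a + 1) (Suc a, x, y, w))"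
    by (simp only: run_add)
  also have "\<dots> = (Suc a, 2 * y - x, 2 * w - (3 * y - 2 * x), 3 * w - 2 * (3 * y - 2 * x))"
    unfolding run_excursion_p[OF assms] by (rule run_excursion_q) (use assms in simp)
  finally show ?thesis .
qed

lemma run_period_right:
  assumes "odd (e + a)"
  shows "run e (2 * k) (Suc a, x, y, w) =
    (Suc a, 2 * (2 * w - y) - x, 3 * (2 * w - y) - 2 * x, 3 * w - 2 * y)"
proof -
  have "2 * k = (2 * (k - a) - 1) + (2 * a + 1)" using ab by simp
  then have "run e (2 * k) (Suc a, x, y, w) =
      run (e + (2 * (k - a) - 1)) (2 * a + 1) (run e (2 * (k - a) - 1) (Suc a, x, y, w))"
    by (simp only: run_add)
  also have "\<dots> = (Suc a, 2 * (2 * w - y) - x, 3 * (2 * w - y) - 2 * x, 3 * w - 2 * y)"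
    unfolding run_excursion_q[OF assms] using assms ab by (intro run_excursion_p) auto
  finally show ?thesis .
qed

text \<open>A period of \<open>2 * k\<close> half-steps takes the colours 0, 1, 2 to 2, 1, 0, and
  the next one takes them back.\<close>

lemma run_left_periodic:
  assumes "even (e + a)"
  shows "run e (4 * k * N) (Suc a, 0, 1, 2) = (Suc a, 0, 1, 2)"
proof (induction N)
  case (Suc N)
  have "4 * k * Suc N = 4 * k * N + (2 * k + 2 * k)" by simp
  then have "run e (4 * k * Suc N) (Suc a, 0, 1, 2) =
      run (e + 4 * k * N + 2 * k) (2 * k) (run (e + 4 * k * N) (2 * k) (Suc a, 0, 1, 2))"
    using Suc by (simp only: run_add)
  also have "\<dots> = (Suc a, 0, 1, 2)"
    using assms by (simp add: run_period_left)
  finally show ?case .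
qed simp

text \<open>With d = \<open>w - x\<close> and h = \<open>w - y\<close>, a period replaces d by -d
  and h by -h - 2d. Two periods therefore fix d and add 4d to h, which is 8 for d = 2.\<close>

lemma run_right_drift:
  assumes "odd (e + a)"
  obtains x y w where "run e (4 * k * N) (Suc a, 0, 1, 2) = (Suc a, x, y, w)"
    "w - x = 2" "w - y = 1 + 8 * int N"
proof -
  have "\<exists>x y w. run e (4 * k * N) (Suc a, 0, 1, 2) = (Suc a, x, y, w) \<and>
      w - x = 2 \<and> w - y = 1 + 8 * int N"
  proof (induction N)
    case (Suc N)
    then obtain x y w where IH: "run e (4 * k * N) (Suc a, 0, 1, 2) = (Suc a, x, y, w)"
      "w - x = 2" "w - y = 1 + 8 * int N" by blast
    have "4 * k * Suc N = 4 * k * N + (2 * k + 2 * k)" by simp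
    then have "run e (4 * k * Suc N) (Suc a, 0, 1, 2) =
        run (e + 4 * k * N + 2 * k) (2 * k) (run (e + 4 * k * N) (2 * k) (Suc a, x, y, w))"
      using IH by (simp only: run_add)
    then show ?case
      using assms IH by (simp add: run_period_right)
  qed simp
  then show thesis using that by blast
qed

lemma run_range:
  assumes "1 \<le> fst u" "fst u \<le> k"
  shows "1 \<le> fst (run e n u) \<and> fst (run e n u) \<le> k"
  using assms
proof (induction n arbitrary: e u)
  case (Suc n)
  then show ?case using half_step_range[of u e] by simp
qed simp

section \<open>Powers of the two orders of the product compared\<close>

lemma fold_cross_two_bricks:
  assumes "bricks e rs" "bricks (Suc e) ss" "1 \<le> fst u" "fst u \<le> k"
  shows "(fold cross (brick_word rs @ brick_word ss) ^^ N) (coloring u) = coloring (run e (2 * N) u)"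
proof (induction N)
  case (Suc N)
  let ?v = "run e (2 * N) u"
  have v: "1 \<le> fst ?v" "fst ?v \<le> k" using run_range assms by blast+
  have "run e (2 * Suc N) u = run (e + 2 * N) 2 ?v"
    using run_add[of e "2 * N" 2 u] by simp
  also have "\<dots> = run e 2 ?v" by (rule run_parity) simp
  finally have "run e (2 * Suc N) u = half_step (Suc e) (half_step e ?v)"
    by (simp add: numeral_2_eq_2)
  then show ?case
    using Suc v assms half_step_range[OF v] by (simp add: brick_word_half_step)
qed simp

lemma coloring_inject:
  assumes "coloring (Suc a, x, y, w) = coloring (Suc a, x', y', w')"
  shows "x = x'" "y = y'" "w = w'"
  using fun_cong[OF assms, of p] fun_cong[OF assms, of q] fun_cong[OF assms, of "pos (Suc a)"]
    pos_neq[of "Suc a"] p_less_q ab by (auto simp: coloring_simps)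

text \<open>The first product sends \<open>z\<close> around \<open>p\<close> first, the second
  around \<open>q\<close> first. The primed lists allow another ordering of the factors within each
  brick word.\<close>

lemma two_bricks_pow_neq:
  assumes "bricks e rs" "bricks (Suc e) ss" "bricks (Suc e) ss'" "bricks e rs'"
    and even: "even (e + a)" and m: "m > 0"
  shows "fold cross (brick_word rs @ brick_word ss) ^^ m \<noteq>
    fold cross (brick_word ss' @ brick_word rs') ^^ m"
proof
  let ?F = "fold cross (brick_word rs @ brick_word ss)"
  let ?G = "fold cross (brick_word ss' @ brick_word rs')"
  let ?u = "(Suc a, 0, 1, 2) :: tracked"
  assume "?F ^^ m = ?G ^^ m"
  \<comment> \<open>The exponent \<open>2 * k\<close> turns the \<open>2 * m\<close> half-steps into
    \<open>4 * k * m\<close>, that is \<open>m\<close> double periods, after which \<open>z\<close>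
    is back at \<open>Suc a\<close> on both sides.\<close>
  then have "(?F ^^ m) ^^ (2 * k) = (?G ^^ m) ^^ (2 * k)" by simp
  then have eq: "?F ^^ (m * (2 * k)) = ?G ^^ (m * (2 * k))" by (simp only: funpow_mult mult.commute)
  have u: "1 \<le> fst ?u" "fst ?u \<le> k" using ab by auto
  have "bricks (Suc (Suc e)) rs'" using assms(4) by (simp add: bricks_def)
  then have "coloring (run e (4 * k * m) ?u) = coloring (run (Suc e) (4 * k * m) ?u)"
    using fun_cong[OF eq, of "coloring ?u"]
      fold_cross_two_bricks[OF assms(1,2) u, of "m * (2 * k)"]
      fold_cross_two_bricks[OF assms(3) _ u, of rs' "m * (2 * k)"]
    by (simp add: mult_ac)
  moreover obtain x y w where "run (Suc e) (4 * k * m) ?u = (Suc a, x, y, w)"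
    "w - x = 2" "w - y = 1 + 8 * int m"
    using run_right_drift[of "Suc e" m] even by auto
  ultimately have "coloring (Suc a, 0, 1, 2) = coloring (Suc a, x, y, w)" "w - y = 1 + 8 * int m"
    using run_left_periodic[OF even] by auto
  \<comment> \<open>Equal colours would give \<open>w - y = 2 - 1\<close>, against
    \<open>1 + 8 * int m\<close> with \<open>m\<close> positive.\<close>
  then show False using coloring_inject m by fastforce
qed

end

section \<open>From elements of the braid monoid to words\<close>

lemma fold_concat_replicate: "fold f (concat (replicate m w)) = fold f w ^^ m"
  by (induction m) (simp_all add: funpow_Suc_right del: funpow.simps(2))

lemma rev_concat_replicate: "rev (concat (replicate m w)) = concat (replicate m (rev w))"
  by (simp add: rev_concat map_replicate)

lemma concat_replicate_lists: "w \<in> lists A \<Longrightarrow> concat (replicate m w) \<in> lists A"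
  by (induction m) auto

lemma braid_class_pow:
  assumes "w \<in> lists {1..n}"
  shows "(braid_cong n `` {w}) [^]\<^bsub>braid_monoid n\<^esub> m = braid_cong n `` {concat (replicate m w)}"
proof (induction m)
  case 0
  then show ?case by (simp add: braid_one)
next
  case (Suc m)
  have "concat (replicate m w) @ w = concat (replicate (Suc m) w)"
    by (induction m) auto
  then show ?case using Suc assms by (simp add: braid_mult_class concat_replicate_lists)
qed

lemma ordered_prod_braid_class:
  assumes "\<forall>w\<in>set ws. w \<in> lists {1..n}"
  shows "ordered_prod (braid_monoid n) (map (\<lambda>w. braid_cong n `` {w}) ws) =
    braid_cong n `` {concat ws}"
  using assms
proof (induction ws)
  case Nil
  then show ?case by (simp add: ordered_prod_def braid_one)
next
  case (Cons w ws)
  then have "w \<in> lists {1..n}" "concat ws \<in> lists {1..n}" by (auto simp: in_lists_conv_set)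
  then show ?case using Cons by (simp add: ordered_prod_def braid_mult_class)
qed

lemma transp_word_lists: "1 \<le> i \<Longrightarrow> j \<le> n + 1 \<Longrightarrow> transp_word i j \<in> lists {1..n}"
  by (auto simp: transp_word_def)

lemma ordered_prod_transp:
  assumes "\<forall>r\<in>set rs. 1 \<le> f r \<and> f r < f (Suc r) \<and> f (Suc r) \<le> n + 1"
  shows "ordered_prod (braid_monoid n) (map (\<lambda>r. braid_transp n (f r) (f (r + 1))) rs) =
    braid_cong n `` {concat (map (\<lambda>r. transp_word (f r) (f (Suc r))) rs)}"
    "concat (map (\<lambda>r. transp_word (f r) (f (Suc r))) rs) \<in> lists {1..n}"
proof -
  let ?ws = "map (\<lambda>r. transp_word (f r) (f (Suc r))) rs"
  have lists: "\<forall>w\<in>set ?ws. w \<in> lists {1..n}"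
    using assms transp_word_lists by auto
  then show "concat ?ws \<in> lists {1..n}" by (auto simp: in_lists_conv_set)
  have "map (\<lambda>r. braid_transp n (f r) (f (r + 1))) rs = map (\<lambda>w. braid_cong n `` {w}) ?ws"
    using assms by (auto simp: braid_transp_class transp_word_def)
  then show "ordered_prod (braid_monoid n) (map (\<lambda>r. braid_transp n (f r) (f (r + 1))) rs) =
      braid_cong n `` {concat ?ws}"
    using ordered_prod_braid_class[OF lists] by (simp only:)
qed

text \<open>The guarded list comprehensions in \<open>tau1\<close> and \<open>tau0\<close> unfold to
  the left-hand side.\<close>

lemma concat_map_if_filter:
  "concat (map (\<lambda>r. if P r then [g r] else []) rs) = map g (filter P rs)"
  by (induction rs) auto

section \<open>Locating two gaps of \<open>J\<close> in its enumeration\<close>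

lemma nth_elem_less:
  assumes "finite J" "1 \<le> r" "r < s" "s \<le> card J"
  shows "nth_elem J r < nth_elem J s"
  using assms sorted_wrt_nth_less[OF strict_sorted_list_of_set, of "r - 1" "s - 1" J]
  by (simp add: nth_elem_def)

lemma nth_elem_in:
  assumes "finite J" "1 \<le> r" "r \<le> card J"
  shows "nth_elem J r \<in> J"
  using assms nth_mem[of "r - 1" "sorted_list_of_set J"] by (simp add: nth_elem_def)

lemma nth_elem_ex:
  assumes "finite J" "j \<in> J"
  obtains r where "1 \<le> r" "r \<le> card J" "nth_elem J r = j"
proof -
  obtain i where "i < card J" "sorted_list_of_set J ! i = j"
    using assms by (metis in_set_conv_nth set_sorted_list_of_set length_sorted_list_of_set)
  then show thesis using that[of "Suc i"] by (simp add: nth_elem_def)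
qed

text \<open>Since \<open>j\<close> is not the minimum it has a predecessor in \<open>J\<close>,
  which is not \<open>j - 1\<close>; so \<open>j - 1\<close> lies strictly between the two.\<close>

lemma gap_index:
  assumes J: "finite J" "j \<in> J" "Min J < j" "j - 1 \<notin> J"
  obtains r where "1 \<le> r" "r < card J" "nth_elem J (Suc r) = j" "nth_elem J r < j - 1"
proof -
  obtain s where s: "1 \<le> s" "s \<le> card J" "nth_elem J s = j" using nth_elem_ex J by metis
  obtain t where t: "1 \<le> t" "t \<le> card J" "nth_elem J t = Min J"
    using nth_elem_ex[OF J(1) Min_in] J by blast
  have "t < s"
    using nth_elem_less[OF J(1), of s t] s t J(3) by (cases s t rule: linorder_cases) auto
  then obtain r where r: "s = Suc r" "1 \<le> r" using t by (cases s) auto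
  have "nth_elem J r < j" "nth_elem J r \<noteq> j - 1"
    using nth_elem_less[OF J(1), of r s] nth_elem_in[OF J(1), of r] r s J(4) by auto
  then show thesis using that[of r] r s by auto
qed

lemma two_gaps_of_gaps:
  assumes "finite J" "gaps J > 1"
  obtains a b p q where "two_gaps (nth_elem J) (card J) a b p q"
proof -
  define G where "G = {j \<in> J. Min J < j \<and> j \<le> Max J \<and> j - 1 \<notin> J}"
  have "finite G" "\<not> card G \<le> Suc 0"
    using assms by (simp_all add: G_def gaps_def)
  then obtain g h where "g \<noteq> h" "g \<in> G" "h \<in> G" using card_le_Suc0_iff_eq by blast
  then have gh: "g \<in> J" "Min J < g" "g - 1 \<notin> J" "h \<in> J" "Min J < h" "h - 1 \<notin> J"
    by (simp_all add: G_def)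
  obtain r where r: "1 \<le> r" "r < card J" "nth_elem J (Suc r) = g" "nth_elem J r < g - 1"
    using gap_index assms(1) gh by metis
  obtain s where s: "1 \<le> s" "s < card J" "nth_elem J (Suc s) = h" "nth_elem J s < h - 1"
    using gap_index assms(1) gh by metis
  \<comment> \<open>The positions just below the upper ends of the two gaps serve as
    \<open>p\<close> and \<open>q\<close>; the claim is kept general because either gap may come
    first.\<close>
  have two_gapsI: "two_gaps (nth_elem J) (card J) t u (nth_elem J (Suc t) - 1) (nth_elem J (Suc u) - 1)"
    if "1 \<le> t" "t < u" "u < card J" "nth_elem J t < nth_elem J (Suc t) - 1"
      "nth_elem J u < nth_elem J (Suc u) - 1" for t u
    by unfold_locales (use that nth_elem_less[OF assms(1)] in auto)
  have "r \<noteq> s" using r s \<open>g \<noteq> h\<close> by auto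
  then show thesis using two_gapsI[of r s] two_gapsI[of s r] r s that by (cases "r < s") auto
qed

theorem theorem5p30:
  fixes n m :: nat and J :: "nat set"
  assumes "n > 1"
    and "{1, n + 1} \<subseteq> J" and "J \<subseteq> {1..n + 1}"
    and "gaps J > 1"
    and "m > 0"
  shows "braid_op n (T_set n J [^]\<^bsub>braid_monoid n\<^esub> m) \<noteq> T_set n J [^]\<^bsub>braid_monoid n\<^esub> m"
proof
  assume inv: "braid_op n (T_set n J [^]\<^bsub>braid_monoid n\<^esub> m) = T_set n J [^]\<^bsub>braid_monoid n\<^esub> m"
  have fin: "finite J" using assms(3) finite_subset by blast
  obtain a b p q where "two_gaps (nth_elem J) (card J) a b p q"
    using two_gaps_of_gaps fin assms(4) by blast
  then interpret two_gaps "nth_elem J" "card J" a b p q .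
  define os es where "os = filter odd [1..<card J]" and "es = filter even [1..<card J]"
  have adj: "1 \<le> nth_elem J r \<and> nth_elem J r < nth_elem J (Suc r) \<and> nth_elem J (Suc r) \<le> n + 1"
    if "r \<in> set [1..<card J]" for r
    using that nth_elem_in[OF fin, of r] nth_elem_in[OF fin, of "Suc r"] pos_less[of r "Suc r"]
      assms(3) by auto
  have tau1: "tau1 n J = braid_cong n `` {brick_word os}" "brick_word os \<in> lists {1..n}"
    using ordered_prod_transp[of os "nth_elem J" n] adj
    by (simp_all add: tau1_def concat_map_if_filter brick_word_def adj_word_def[abs_def] os_def)
  have tau0: "tau0 n J = braid_cong n `` {brick_word es}" "brick_word es \<in> lists {1..n}"
    using ordered_prod_transp[of es "nth_elem J" n] adj
    by (simp_all add: tau0_def concat_map_if_filter brick_word_def adj_word_def[abs_def] es_def)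
  \<comment> \<open>Each transposition word is a palindrome, so reversal only reverses the order of
    the factors.\<close>
  have rev_brick: "rev (brick_word rs) = brick_word (rev rs)" if "set rs \<subseteq> set [1..<card J]" for rs
  proof -
    have "map (rev \<circ> adj_word) rs = map adj_word rs"
      using that adj by (auto simp: adj_word_def rev_transp_word subset_iff)
    then have "concat (rev (map (rev \<circ> adj_word) rs)) = concat (rev (map adj_word rs))"
      by (simp only:)
    then show ?thesis by (simp add: brick_word_def rev_concat flip: rev_map)
  qed
  let ?W = "brick_word os @ brick_word es"
  have W: "?W \<in> lists {1..n}" using tau1(2) tau0(2) by simp
  have revW: "rev ?W = brick_word (rev es) @ brick_word (rev os)"
  proof -
    have "set os \<subseteq> set [1..<card J]" "set es \<subseteq> set [1..<card J]"
      unfolding os_def es_def by (simp_all only: filter_is_subset)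
    then show ?thesis by (simp only: rev_append rev_brick)
  qed
  have "T_set n J = braid_cong n `` {?W}"
    unfolding T_set_def tau1(1) tau0(1) using tau1(2) tau0(2) by (rule braid_mult_class)
  then have "braid_cong n `` {concat (replicate m (rev ?W))} =
      braid_cong n `` {concat (replicate m ?W)}"
    using inv concat_replicate_lists[OF W]
    by (simp only: braid_class_pow[OF W] braid_op_class rev_concat_replicate)
  moreover have "rev ?W \<in> lists {1..n}" using W by auto
  ultimately have "(concat (replicate m (rev ?W)), concat (replicate m ?W)) \<in> braid_cong n"
    using W by (subst (asm) braid_class_eq_iff) (simp_all only: concat_replicate_lists)
  then have eq: "fold cross (brick_word os @ brick_word es) ^^ m =
      fold cross (brick_word (rev es) @ brick_word (rev os)) ^^ m"
    unfolding revW by (metis fold_cross_cong fold_concat_replicate ext)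
  \<comment> \<open>\<open>tau0\<close> is recorded under both 0 and 2, so that it can precede or
    follow the parity 1 of \<open>tau1\<close>.\<close>
  have bricks: "bricks 1 os" "bricks 2 es" "bricks 0 es"
    "bricks 1 (rev os)" "bricks 2 (rev es)" "bricks 0 (rev es)"
    by (auto simp: bricks_def os_def es_def)
  show False
  \<comment> \<open>From \<open>Suc a\<close> the strand \<open>z\<close> starts leftwards when the
    product begins with indices of the parity of \<open>a\<close>: this is the reversed word for
    even \<open>a\<close> and the word itself for odd \<open>a\<close>.\<close>
  proof (cases "even a")
    case True
    then show False
      using two_bricks_pow_neq[of 0 "rev es" "rev os" os es m] bricks assms(5) eq by simp
  next
    case False
    have "bricks (Suc 1) es" "bricks (Suc 1) (rev es)"
      using bricks by (simp_all add: numeral_2_eq_2)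
    from two_bricks_pow_neq[OF bricks(1) this bricks(4) _ assms(5)] show False
      using False eq by simp
  qed
qed

end
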